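(* For every $q$, \[ \mathbb E\,\beta_{\boldsymbol n}^{\Omega}(K;y)=[p(q)-y]^\top\Omega[p(q)-y]. \] Let \[ b_{\boldsymbol n}^{\Omega}(y)=\Bigl[-\min_{0\le k_j\le n_j}\beta_{\boldsymbol n}^{\Omega}(k;y)\Bigr]_+,\qquad C_{\boldsymbol n}^{\Omega}(y)=\max\Bigl\{1,\max_k\bigl[\beta_{\boldsymbol n}^{\Omega}(k;y)+b_{\boldsymbol n}^{\Omega}(y)\bigr]\Bigr\}, \] where the minimum and maximum are over integer vectors $k=(k_1,\dots,k_J)$ with $0\le k_j\le n_j$ for all $j$, and $[x]_+=\max\{x,0\}$. Conditional on $K$, generate \[ H_{\boldsymbol n,y}^{\Omega}\sim\operatorname{Bernoulli}\!\left(\frac{\beta_{\boldsymbol n}^{\Omega}(K;y)+b_{\boldsymbol n}^{\Omega}(y)}{C_{\boldsymbol n}^{\Omega}(y)}\right). \] If $R\sim\operatorname{Poisson}(a_\sigma C_{\boldsymbol n}^{\Omega}(y))$ and $G_{\boldsymbol n,y}^{\Omega}=1$ exactly when all of $R$ independent copies of $H_{\boldsymbol n,y}^{\Omega}$ (independent of $R$) are zero, with $G_{\boldsymbol n,y}^{\Omega}=0$ otherwise, then \[ \mathbb P(G_{\boldsymbol n,y}^{\Omega}=1)=e^{-a_\sigma b_{\boldsymbol n}^{\Omega}(y)}L_\Sigma(q;y). \]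
   Context: Correlated Gaussian observation model: $y=p(q)+\varepsilon\in\mathbb R^J$, $\varepsilon\sim\mathcal N(0,\sigma^2\Sigma)$, $\sigma>0$, $\Omega=\Sigma^{-1}\succ0$ (symmetric positive definite), where $q$ is the unknown parameter and $p(q)=(p_1(q),\ldots,p_J(q))^\top\in[0,1]^J$. Put $a_\sigma=(2\sigma^2)^{-1}$; the data $y$ are fixed and the reduced likelihood is \[ L_\Sigma(q;y)=\exp\{-a_\sigma[p(q)-y]^\top\Omega[p(q)-y]\}. \] Choose integer orders $\boldsymbol n=(n_1,\dots,n_J)$ with $n_j\ge2$. For fixed $q$, let $K=(K_1,\dots,K_J)$ have independent components $K_j\sim\operatorname{Binomial}(n_j,p_j(q))$. For an integer vector $k$ with $0\le k_j\le n_j$ put $\widehat p_j=k_j/n_j$, $\widehat p_j^{[2]}=\dfrac{k_j(k_j-1)}{n_j(n_j-1)}$, $\widehat p=(\widehat p_1,\dots,\widehat p_J)^\top$, and \[ \beta_{\boldsymbol n}^{\Omega}(k;y)=y^\top\Omega y-2y^\top\Omega\widehat p+\sum_{j=1}^J\Omega_{jj}\widehat p_j^{[2]}+2\sum_{1\le i<j\le J}\Omega_{ij}\widehat p_i\widehat p_j . \] *)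

theory Defs
  imports "HOL-Analysis.Analysis" "HOL-Probability.Probability"
begin

text \<open>
  The coordinates are indexed by a finite linearly ordered type \<open>'j\<close> of cardinality \<open>J\<close>; the order is
  used only to write the double sum over pairs \<open>i < j\<close>.
\<close>

text \<open>
  These are \<open>real ^ 'j\<close> and \<open>real ^ 'j ^ 'j\<close>; that notation would force the sort of \<open>'j\<close> to be
  exactly \<^class>\<open>finite\<close>.
\<close>

type_synonym 'j rvec = "(real, 'j) vec"
type_synonym 'j rmat = "((real, 'j) vec, 'j) vec"

definition sym_posdef :: "'j::finite rmat \<Rightarrow> bool" where
  "sym_posdef A \<longleftrightarrow> transpose A = A \<and> (\<forall>x. x \<noteq> 0 \<longrightarrow> 0 < x \<bullet> (A *v x))"

definition a_coef :: "real \<Rightarrow> real" where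
  "a_coef \<sigma> = 1 / (2 * \<sigma>\<^sup>2)"

text \<open>
  The likelihood of \<open>y = p(q) + \<epsilon>\<close> with \<open>\<epsilon>\<close> centred Gaussian of covariance \<open>\<sigma>\<^sup>2 \<Sigma>\<close>, without its
  normalising constant.
\<close>

definition reduced_likelihood ::
  "real \<Rightarrow> 'j::finite rmat \<Rightarrow> ('q \<Rightarrow> 'j rvec) \<Rightarrow> 'q \<Rightarrow> 'j rvec \<Rightarrow> real" where
  "reduced_likelihood \<sigma> \<Sigma> p q y =
     exp (- a_coef \<sigma> * ((p q - y) \<bullet> (matrix_inv \<Sigma> *v (p q - y))))"

definition phat :: "('j::finite \<Rightarrow> nat) \<Rightarrow> ('j \<Rightarrow> nat) \<Rightarrow> 'j rvec" where
  "phat n k = (\<chi> j. real (k j) / real (n j))"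

definition phat2 :: "('j::finite \<Rightarrow> nat) \<Rightarrow> ('j \<Rightarrow> nat) \<Rightarrow> 'j rvec" where
  "phat2 n k = (\<chi> j. (real (k j) * (real (k j) - 1)) / (real (n j) * (real (n j) - 1)))"

definition beta ::
  "('j::{finite,linorder} \<Rightarrow> nat) \<Rightarrow> 'j rmat \<Rightarrow> 'j rvec \<Rightarrow> ('j \<Rightarrow> nat) \<Rightarrow> real" where
  "beta n \<Omega> y k =
     y \<bullet> (\<Omega> *v y) - 2 * (y \<bullet> (\<Omega> *v phat n k))
     + (\<Sum>j\<in>UNIV. \<Omega> $ j $ j * phat2 n k $ j)
     + 2 * (\<Sum>(i, j)\<in>{(i, j). i < j}. \<Omega> $ i $ j * phat n k $ i * phat n k $ j)"

definition grid :: "('j \<Rightarrow> nat) \<Rightarrow> ('j \<Rightarrow> nat) set" where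
  "grid n = {k. \<forall>j. k j \<le> n j}"

definition b_shift ::
  "('j::{finite,linorder} \<Rightarrow> nat) \<Rightarrow> 'j rmat \<Rightarrow> 'j rvec \<Rightarrow> real" where
  "b_shift n \<Omega> y = max (- Min (beta n \<Omega> y ` grid n)) 0"

definition C_bound ::
  "('j::{finite,linorder} \<Rightarrow> nat) \<Rightarrow> 'j rmat \<Rightarrow> 'j rvec \<Rightarrow> real" where
  "C_bound n \<Omega> y = max 1 (Max ((\<lambda>k. beta n \<Omega> y k + b_shift n \<Omega> y) ` grid n))"

definition H_param ::
  "('j::{finite,linorder} \<Rightarrow> nat) \<Rightarrow> 'j rmat \<Rightarrow> 'j rvec \<Rightarrow> ('j \<Rightarrow> nat) \<Rightarrow> real" where
  "H_param n \<Omega> y k = (beta n \<Omega> y k + b_shift n \<Omega> y) / C_bound n \<Omega> y"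

text \<open>
  The laws of \<open>K\<close>, \<open>H\<close> and \<open>G\<close>, where the vector \<open>P\<close> stands for \<open>p(q)\<close>. As \<open>K\<close> is indexed by all of
  \<open>UNIV\<close>, the default value given to \<^const>\<open>Pi_pmf\<close> plays no role. Values in \<open>{0, 1}\<close> are
  represented as \<^typ>\<open>bool\<close>, with \<^const>\<open>True\<close> for \<open>1\<close>. Note that \<^const>\<open>bernoulli_pmf\<close> clips its
  argument to the unit interval.
\<close>

definition K_pmf :: "('j::finite \<Rightarrow> nat) \<Rightarrow> 'j rvec \<Rightarrow> ('j \<Rightarrow> nat) pmf" where
  "K_pmf n P = Pi_pmf UNIV 0 (\<lambda>j. binomial_pmf (n j) (P $ j))"

definition H_pmf ::
  "('j::{finite,linorder} \<Rightarrow> nat) \<Rightarrow> 'j rmat \<Rightarrow> 'j rvec \<Rightarrow> 'j rvec \<Rightarrow> bool pmf" where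
  "H_pmf n \<Omega> y P = bind_pmf (K_pmf n P) (\<lambda>k. bernoulli_pmf (H_param n \<Omega> y k))"

definition G_pmf ::
  "real \<Rightarrow> ('j::{finite,linorder} \<Rightarrow> nat) \<Rightarrow> 'j rmat \<Rightarrow> 'j rvec \<Rightarrow> 'j rvec \<Rightarrow> bool pmf" where
  "G_pmf \<sigma> n \<Omega> y P =
     bind_pmf (poisson_pmf (a_coef \<sigma> * C_bound n \<Omega> y)) (\<lambda>r.
       map_pmf (\<lambda>hs. \<forall>h\<in>set hs. \<not> h) (replicate_pmf r (H_pmf n \<Omega> y P)))"

end

theory Submission
  imports Defs
begin

text \<open>
  Expanding the quadratic form with \<open>\<Omega>\<close> symmetric gives
  \<open>(P - y)\<^sup>T \<Omega> (P - y) = y\<^sup>T \<Omega> y - 2 y\<^sup>T \<Omega> P + (\<Sum>j. \<Omega>\<^sub>j\<^sub>j P\<^sub>j\<^sup>2) + 2 (\<Sum>i<j. \<Omega>\<^sub>i\<^sub>j P\<^sub>i P\<^sub>j)\<close>,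
  a polynomial in \<open>P\<close> each of whose monomials has an unbiased estimator: \<open>k\<^sub>j / n\<^sub>j\<close> for \<open>P\<^sub>j\<close>,
  by independence the product of two such ratios for \<open>P\<^sub>i P\<^sub>j\<close> with \<open>i \<noteq> j\<close>, and the normalised
  second factorial moment \<open>k\<^sub>j (k\<^sub>j - 1) / (n\<^sub>j (n\<^sub>j - 1))\<close> for \<open>P\<^sub>j\<^sup>2\<close>. Replacing monomials by
  estimators turns the polynomial into \<^const>\<open>beta\<close>, so \<open>\<beta>(K)\<close> is an unbiased estimator of the
  quadratic form (\<open>expectation_beta\<close>).

  The shift by \<open>b\<close> and the division by \<open>C\<close> place \<open>\<beta>\<close> in the unit interval on all of the grid
  (\<open>H_param_bounds\<close>). Hence the coin \<open>H\<close> shows \<open>1\<close> with probability exactly \<open>(Q + b) / C\<close>, where \<open>Q\<close> is the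
  quadratic form: a Bernoulli variable with random parameter depends only on the mean of that
  parameter (\<open>pmf_H_True\<close>). Finally, if each of \<open>R \<sim> Poisson \<lambda>\<close> independent coins shows \<open>0\<close> with
  probability \<open>c\<close>, all of them do so with probability \<open>E c\<^sup>R = exp (- \<lambda> (1 - c))\<close>, the
  probability generating function of the Poisson law (\<open>expectation_power_poisson\<close>).
  For \<open>\<lambda> = a C\<close> and \<open>1 - c = (Q + b) / C\<close> the constant \<open>C\<close> cancels, and the result
  \<open>exp (- a (Q + b))\<close> factors into \<open>exp (- a b)\<close> and the likelihood.
\<close>

section \<open>Moments of independent binomial variables\<close>

text \<open>
  The binomial weights are the Bernstein polynomials evaluated at \<open>p\<close>, whose first two factorial
  moments are known.
\<close>

lemma expectation_binomial_pmf_conv_Bernstein: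
  fixes f :: "nat \<Rightarrow> real"
  assumes "p \<in> {0..1}"
  shows "measure_pmf.expectation (binomial_pmf n p) f = (\<Sum>k\<le>n. f k * Bernstein n k p)"
  using assms by (simp add: expectation_binomial_pmf' Bernstein_def mult_ac)

lemma expectation_binomial_ratio:
  assumes "p \<in> {0..1}" "n > 0"
  shows "measure_pmf.expectation (binomial_pmf n p) (\<lambda>k. real k / real n) = p"
  using assms by (simp add: expectation_binomial_pmf_conv_Bernstein sum_k_Bernstein)

lemma expectation_binomial_factorial_ratio:
  assumes "p \<in> {0..1}" "n \<ge> 2"
  shows "measure_pmf.expectation (binomial_pmf n p)
           (\<lambda>k. (real k * (real k - 1)) / (real n * (real n - 1))) = p\<^sup>2"
proof -
  have "measure_pmf.expectation (binomial_pmf n p) (\<lambda>k. real k * (real k - 1))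
          = real n * (real n - 1) * p\<^sup>2"
    using assms sum_kk_Bernstein[of n p] by (simp add: expectation_binomial_pmf_conv_Bernstein)
  with assms show ?thesis by simp
qed

lemma expectation_Pi_pmf_component:
  fixes f :: "'b \<Rightarrow> real"
  assumes "finite A" "i \<in> A"
  shows "measure_pmf.expectation (Pi_pmf A dflt p) (\<lambda>k. f (k i)) = measure_pmf.expectation (p i) f"
proof -
  have "measure_pmf.expectation (p i) f
          = measure_pmf.expectation (map_pmf (\<lambda>k. k i) (Pi_pmf A dflt p)) f"
    using assms by (simp add: Pi_pmf_component)
  then show ?thesis by simp
qed

lemma expectation_Pi_pmf_prod_pair:
  fixes f :: "'a \<Rightarrow> 'b \<Rightarrow> real"
  assumes "finite A" "i \<in> A" "j \<in> A" "i \<noteq> j"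
    and "\<And>x. x \<in> {i, j} \<Longrightarrow> integrable (measure_pmf (p x)) (f x)"
    and "\<And>x v. x \<in> {i, j} \<Longrightarrow> v \<in> set_pmf (p x) \<Longrightarrow> f x v \<ge> 0"
  shows "measure_pmf.expectation (Pi_pmf A dflt p) (\<lambda>k. f i (k i) * f j (k j))
           = measure_pmf.expectation (p i) (f i) * measure_pmf.expectation (p j) (f j)"
proof -
  \<comment> \<open>The product formula ranges over all of \<open>A\<close>, so the other coordinates get the factor \<open>1\<close>.\<close>
  let ?g = "\<lambda>x v. if x \<in> {i, j} then f x v else 1"
  have pair: "(\<Prod>x\<in>A. h x) = h i * h j" if "\<And>x. x \<in> A - {i, j} \<Longrightarrow> h x = 1" for h :: "'a \<Rightarrow> real"
  proof -
    have "(\<Prod>x\<in>A. h x) = (\<Prod>x\<in>{i, j}. h x)"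
      using assms that by (intro prod.mono_neutral_right) auto
    with assms show ?thesis by simp
  qed
  have "integrable (measure_pmf (p x)) (?g x)" for x
    using assms(5) by (cases "x \<in> {i, j}") auto
  then have "measure_pmf.expectation (Pi_pmf A dflt p) (\<lambda>k. \<Prod>x\<in>A. ?g x (k x))
               = (\<Prod>x\<in>A. measure_pmf.expectation (p x) (?g x))"
    using assms by (intro expectation_prod_Pi_pmf) auto
  moreover have "(\<Prod>x\<in>A. ?g x (k x)) = f i (k i) * f j (k j)" for k
    using pair[of "\<lambda>x. ?g x (k x)"] by simp
  moreover have "(\<Prod>x\<in>A. measure_pmf.expectation (p x) (?g x))
                   = measure_pmf.expectation (p i) (f i) * measure_pmf.expectation (p j) (f j)"
    using pair[of "\<lambda>x. measure_pmf.expectation (p x) (?g x)"] by simp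
  ultimately show ?thesis by simp
qed

section \<open>Unbiasedness\<close>

lemma finite_grid: "finite (grid n)" for n :: "'j::finite \<Rightarrow> nat"
proof -
  have "grid n = (\<Pi>\<^sub>E j\<in>UNIV. {..n j})"
    by (auto simp: grid_def PiE_def Pi_def)
  then show ?thesis by (simp add: finite_PiE)
qed

lemma set_K_pmf_subset_grid:
  assumes "\<And>j. P $ j \<in> {0..1}"
  shows "set_pmf (K_pmf n P) \<subseteq> grid n"
proof
  fix k assume "k \<in> set_pmf (K_pmf n P)"
  then have k: "k j \<in> set_pmf (binomial_pmf (n j) (P $ j))" for j
    by (auto simp: K_pmf_def set_Pi_pmf PiE_dflt_def)
  have "k j \<le> n j" for j
    using k[of j] assms[of j] by (auto simp: set_pmf_binomial_eq split: if_splits)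
  then show "k \<in> grid n"
    by (simp add: grid_def)
qed

lemma integrable_K_pmf:
  fixes f :: "('j::finite \<Rightarrow> nat) \<Rightarrow> real"
  assumes "\<And>j. P $ j \<in> {0..1}"
  shows "integrable (measure_pmf (K_pmf n P)) f"
  using finite_subset[OF set_K_pmf_subset_grid finite_grid] assms
  by (intro integrable_measure_pmf_finite) blast

lemma expectation_phat:
  assumes "\<And>j. P $ j \<in> {0..1}" "n j > 0"
  shows "measure_pmf.expectation (K_pmf n P) (\<lambda>k. phat n k $ j) = P $ j"
  using assms expectation_binomial_ratio[of "P $ j" "n j"]
    expectation_Pi_pmf_component[of UNIV j 0 "\<lambda>j. binomial_pmf (n j) (P $ j)"
      "\<lambda>v. real v / real (n j)"]
  by (simp add: K_pmf_def phat_def)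

lemma expectation_phat2:
  assumes "\<And>j. P $ j \<in> {0..1}" "n j \<ge> 2"
  shows "measure_pmf.expectation (K_pmf n P) (\<lambda>k. phat2 n k $ j) = (P $ j)\<^sup>2"
  using assms expectation_binomial_factorial_ratio[of "P $ j" "n j"]
    expectation_Pi_pmf_component[of UNIV j 0 "\<lambda>j. binomial_pmf (n j) (P $ j)"
      "\<lambda>v. (real v * (real v - 1)) / (real (n j) * (real (n j) - 1))"]
  by (simp add: K_pmf_def phat2_def)

lemma expectation_phat_mult:
  assumes "\<And>j. P $ j \<in> {0..1}" "n i > 0" "n j > 0" "i \<noteq> j"
  shows "measure_pmf.expectation (K_pmf n P) (\<lambda>k. phat n k $ i * phat n k $ j) = P $ i * P $ j"
proof -
  have "measure_pmf.expectation (K_pmf n P) (\<lambda>k. real (k i) / real (n i) * (real (k j) / real (n j)))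
      = measure_pmf.expectation (binomial_pmf (n i) (P $ i)) (\<lambda>v. real v / real (n i))
        * measure_pmf.expectation (binomial_pmf (n j) (P $ j)) (\<lambda>v. real v / real (n j))"
    unfolding K_pmf_def using assms
    by (intro expectation_Pi_pmf_prod_pair[where f = "\<lambda>x v. real v / real (n x)"])
       (auto intro!: integrable_measure_pmf_finite)
  also have "\<dots> = P $ i * P $ j"
    using assms by (simp only: expectation_binomial_ratio)
  finally show ?thesis by (simp add: phat_def)
qed

text \<open>
  Symmetry identifies the entries below the diagonal with those above it, whence the factor
  \<open>2\<close>.
\<close>

lemma quadratic_form_symmetric:
  fixes A :: "'j::{finite,linorder} rmat"
  assumes "transpose A = A"
  shows "x \<bullet> (A *v x) = (\<Sum>j\<in>UNIV. A $ j $ j * (x $ j)\<^sup>2)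
           + 2 * (\<Sum>(i, j)\<in>{(i, j). i < j}. A $ i $ j * x $ i * x $ j)"
proof -
  let ?f = "\<lambda>(i, j). A $ i $ j * x $ i * x $ j"
  let ?L = "{(i, j). i < j} :: ('j \<times> 'j) set"
  let ?G = "{(i, j). j < i} :: ('j \<times> 'j) set"
  let ?D = "{(i, j). i = j} :: ('j \<times> 'j) set"
  have sym: "A $ j $ i = A $ i $ j" for i j
    using assms by (metis transpose_def vec_lambda_beta)
  have "x \<bullet> (A *v x) = (\<Sum>i\<in>UNIV. \<Sum>j\<in>UNIV. A $ i $ j * x $ i * x $ j)"
    by (simp add: inner_vec_def matrix_vector_mult_def sum_distrib_left mult_ac)
  also have "\<dots> = sum ?f UNIV"
    by (simp add: sum.cartesian_product)
  also have "UNIV = ?D \<union> (?L \<union> ?G)"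
    by auto
  also have "sum ?f \<dots> = sum ?f ?D + (sum ?f ?L + sum ?f ?G)"
    by (subst sum.union_disjoint, auto)+
  also have "sum ?f ?G = sum ?f ?L"
    by (rule sum.reindex_bij_witness[where i = prod.swap and j = prod.swap]) (auto simp: sym)
  also have "sum ?f ?D = (\<Sum>j\<in>UNIV. A $ j $ j * (x $ j)\<^sup>2)"
    by (rule sum.reindex_bij_witness[where i = "\<lambda>j. (j, j)" and j = fst])
       (auto simp: power2_eq_square)
  finally show ?thesis by simp
qed

lemma quadratic_form_diff_symmetric:
  fixes A :: "'j::finite rmat"
  assumes "transpose A = A"
  shows "(x - y) \<bullet> (A *v (x - y)) = y \<bullet> (A *v y) - 2 * (y \<bullet> (A *v x)) + x \<bullet> (A *v x)"
proof -
  have "x \<bullet> (A *v y) = y \<bullet> (A *v x)"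
    using assms by (metis dot_lmul_matrix inner_commute transpose_matrix_vector)
  then show ?thesis
    by (simp add: matrix_vector_mult_diff_distrib inner_diff_left inner_diff_right)
qed

lemma expectation_beta:
  fixes \<Omega> :: "'j::{finite,linorder} rmat"
  assumes sym: "transpose \<Omega> = \<Omega>"
    and P: "\<And>j. P $ j \<in> {0..1}"
    and n: "\<And>j. n j \<ge> 2"
  shows "measure_pmf.expectation (K_pmf n P) (beta n \<Omega> y) = (P - y) \<bullet> (\<Omega> *v (P - y))"
proof -
  let ?E = "measure_pmf.expectation (K_pmf n P)"
  note int = integrable_K_pmf[OF P, of n]
  have n0: "n j > 0" for j
    using n[of j] by simp
  have lin: "?E (\<lambda>k. y \<bullet> (\<Omega> *v phat n k)) = y \<bullet> (\<Omega> *v P)"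
  proof -
    have inner_sum: "y \<bullet> (\<Omega> *v x) = (\<Sum>j\<in>UNIV. (y v* \<Omega>) $ j * x $ j)" for x
      unfolding dot_lmul_matrix[symmetric] by (simp add: inner_vec_def)
    show ?thesis
      unfolding inner_sum using int by (simp add: expectation_phat[where n = n, OF P n0])
  qed
  have diag: "?E (\<lambda>k. \<Sum>j\<in>UNIV. \<Omega> $ j $ j * phat2 n k $ j) = (\<Sum>j\<in>UNIV. \<Omega> $ j $ j * (P $ j)\<^sup>2)"
    using int by (simp add: expectation_phat2[where n = n, OF P n])
  have off: "?E (\<lambda>k. \<Sum>(i, j)\<in>{(i, j). i < j}. \<Omega> $ i $ j * phat n k $ i * phat n k $ j)
               = (\<Sum>(i, j)\<in>{(i, j). i < j}. \<Omega> $ i $ j * P $ i * P $ j)"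
    unfolding case_prod_unfold mult.assoc
    by (subst Bochner_Integration.integral_sum)
       (auto simp: expectation_phat_mult[where n = n, OF P n0 n0] int intro!: sum.cong)
  have "?E (beta n \<Omega> y) = y \<bullet> (\<Omega> *v y) - 2 * (y \<bullet> (\<Omega> *v P))
      + (\<Sum>j\<in>UNIV. \<Omega> $ j $ j * (P $ j)\<^sup>2)
      + 2 * (\<Sum>(i, j)\<in>{(i, j). i < j}. \<Omega> $ i $ j * P $ i * P $ j)"
    unfolding beta_def
    by (simp only: Bochner_Integration.integral_add Bochner_Integration.integral_diff int
          Bochner_Integration.integral_mult_right_zero lin diag off) simp
  also have "\<dots> = (P - y) \<bullet> (\<Omega> *v (P - y))"
    by (simp add: quadratic_form_diff_symmetric[OF sym] quadratic_form_symmetric[OF sym, of P])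
  finally show ?thesis .
qed

section \<open>The Bernoulli variable driven by the estimator\<close>

lemma C_bound_ge_1: "C_bound n \<Omega> y \<ge> 1"
  by (simp add: C_bound_def)

lemma H_param_bounds:
  assumes "k \<in> grid n"
  shows "0 \<le> H_param n \<Omega> y k \<and> H_param n \<Omega> y k \<le> 1"
proof -
  have "Min (beta n \<Omega> y ` grid n) \<le> beta n \<Omega> y k"
    using assms by (simp add: finite_grid)
  then have "0 \<le> beta n \<Omega> y k + b_shift n \<Omega> y"
    by (simp add: b_shift_def)
  moreover have "beta n \<Omega> y k + b_shift n \<Omega> y
                   \<le> Max ((\<lambda>k. beta n \<Omega> y k + b_shift n \<Omega> y) ` grid n)"
    using assms by (intro Max_ge) (auto simp: finite_grid)
  then have "beta n \<Omega> y k + b_shift n \<Omega> y \<le> C_bound n \<Omega> y"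
    by (simp add: C_bound_def)
  ultimately show ?thesis
    using C_bound_ge_1[of n \<Omega> y] by (simp add: H_param_def)
qed

text \<open>
  This is where the bounds on the parameter matter: outside the unit interval the Bernoulli law
  would be clipped, and its success probability would no longer be linear in \<open>\<beta>\<close>.
\<close>

lemma pmf_H_True:
  fixes \<Omega> :: "'j::{finite,linorder} rmat"
  assumes "transpose \<Omega> = \<Omega>" and P: "\<And>j. P $ j \<in> {0..1}" and "\<And>j. n j \<ge> 2"
  shows "pmf (H_pmf n \<Omega> y P) True
           = ((P - y) \<bullet> (\<Omega> *v (P - y)) + b_shift n \<Omega> y) / C_bound n \<Omega> y"
proof -
  have "pmf (H_pmf n \<Omega> y P) True
          = measure_pmf.expectation (K_pmf n P) (\<lambda>k. pmf (bernoulli_pmf (H_param n \<Omega> y k)) True)"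
    by (simp add: H_pmf_def pmf_bind)
  also have "\<dots> = measure_pmf.expectation (K_pmf n P) (H_param n \<Omega> y)"
  proof (intro integral_cong_AE AE_pmfI)
    fix k assume "k \<in> set_pmf (K_pmf n P)"
    then have "k \<in> grid n"
      using set_K_pmf_subset_grid P by blast
    then show "pmf (bernoulli_pmf (H_param n \<Omega> y k)) True = H_param n \<Omega> y k"
      using H_param_bounds by (intro pmf_bernoulli_True) auto
  qed auto
  also have "\<dots> = (measure_pmf.expectation (K_pmf n P) (beta n \<Omega> y) + b_shift n \<Omega> y) / C_bound n \<Omega> y"
    using integrable_K_pmf[OF P, of n] by (simp add: H_param_def[abs_def])
  finally show ?thesis
    using assms by (simp add: expectation_beta)
qed

section \<open>A Poisson number of independent copies\<close>

text \<open>
  Multiplying the Poisson weights by \<open>c\<^sup>r\<close> turns \<open>rate\<^sup>r\<close> into \<open>(rate * c)\<^sup>r\<close>, so that the sum is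
  \<open>exp (- rate)\<close> times the exponential series at \<open>rate * c\<close>.
\<close>

lemma expectation_power_poisson:
  fixes c :: real
  assumes "0 < rate"
  shows "measure_pmf.expectation (poisson_pmf rate) (\<lambda>r. c ^ r) = exp (- rate * (1 - c))"
proof -
  let ?t = "\<lambda>r. pmf (poisson_pmf rate) r * c ^ r"
  have t: "?t r = exp (- rate) * ((rate * c) ^ r /\<^sub>R fact r)" for r
    using assms by (simp add: power_mult_distrib divide_inverse mult_ac)
  have abs_t: "norm (?t r) = exp (- rate) * ((rate * \<bar>c\<bar>) ^ r /\<^sub>R fact r)" for r
    using assms by (simp add: abs_mult power_abs power_mult_distrib divide_inverse mult_ac)
  have "summable (\<lambda>r. norm (?t r))"
    unfolding abs_t by (intro summable_mult summable_exp_generic)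
  then have int: "integrable (count_space UNIV) ?t"
    by (simp only: integrable_count_space_nat_iff)
  have "measure_pmf.expectation (poisson_pmf rate) (\<lambda>r. c ^ r) = (\<integral>r. ?t r \<partial>count_space UNIV)"
    unfolding measure_pmf_eq_density by (subst integral_density) auto
  also have "\<dots> = (\<Sum>r. ?t r)"
    using sums_integral_count_space_nat[OF int] by (simp add: sums_iff)
  also have "\<dots> = exp (- rate) * exp (rate * c)"
    unfolding t exp_def by (intro suminf_mult summable_exp_generic)
  also have "\<dots> = exp (- rate * (1 - c))"
    by (simp add: exp_add[symmetric] algebra_simps)
  finally show ?thesis .
qed

lemma pmf_replicate_all_False:
  "pmf (map_pmf (\<lambda>hs. \<forall>h\<in>set hs. \<not> h) (replicate_pmf r H)) True = pmf H False ^ r"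
proof (induction r)
  case 0
  then show ?case by simp
next
  case (Suc r)
  have "pmf (map_pmf (\<lambda>hs. \<forall>h\<in>set hs. \<not> h) (replicate_pmf (Suc r) H)) True
      = measure_pmf.expectation H
          (\<lambda>h. pmf (map_pmf (\<lambda>hs. \<not> h \<and> (\<forall>h\<in>set hs. \<not> h)) (replicate_pmf r H)) True)"
    by (simp add: map_bind_pmf map_pmf_def[symmetric] pmf_bind pmf.map_comp o_def)
  also have "\<dots> = measure_pmf.expectation H (\<lambda>h. if h then 0 else pmf H False ^ r)"
    by (intro Bochner_Integration.integral_cong refl) (simp add: Suc map_pmf_const)
  also have "\<dots> = pmf H False ^ Suc r"
    by (subst integral_measure_pmf_real[where A = UNIV]) (auto simp: UNIV_bool)
  finally show ?case .
qed

lemma pmf_G_True: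
  assumes "0 < a_coef \<sigma>"
  shows "pmf (G_pmf \<sigma> n \<Omega> y P) True
           = exp (- a_coef \<sigma> * C_bound n \<Omega> y * pmf (H_pmf n \<Omega> y P) True)"
proof -
  let ?H = "H_pmf n \<Omega> y P"
  have "pmf (G_pmf \<sigma> n \<Omega> y P) True
      = measure_pmf.expectation (poisson_pmf (a_coef \<sigma> * C_bound n \<Omega> y)) (\<lambda>r. pmf ?H False ^ r)"
    by (simp add: G_pmf_def pmf_bind pmf_replicate_all_False)
  also have "\<dots> = exp (- (a_coef \<sigma> * C_bound n \<Omega> y) * (1 - pmf ?H False))"
    using assms C_bound_ge_1[of n \<Omega> y] by (intro expectation_power_poisson) simp
  also have "1 - pmf ?H False = pmf ?H True"
    by (simp add: pmf_False_conv_True)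
  finally show ?thesis by simp
qed

section \<open>Exact simulation of the likelihood\<close>

theorem theorem3p5:
  fixes \<sigma> :: real
    and \<Sigma> \<Omega> :: "('j::{finite,linorder}) rmat"
    and p :: "'q \<Rightarrow> 'j rvec"
    and y :: "'j rvec"
    and n :: "'j \<Rightarrow> nat"
  assumes "\<sigma> > 0"
    and "invertible \<Sigma>"
    and "\<Omega> = matrix_inv \<Sigma>"
    and "sym_posdef \<Omega>"
    and "\<And>q j. 0 \<le> p q $ j \<and> p q $ j \<le> 1"
    and "\<And>j. n j \<ge> 2"
  shows "(\<forall>q. measure_pmf.expectation (K_pmf n (p q)) (beta n \<Omega> y)
               = (p q - y) \<bullet> (\<Omega> *v (p q - y)))
       \<and> (\<forall>k\<in>grid n. 0 \<le> H_param n \<Omega> y k \<and> H_param n \<Omega> y k \<le> 1)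
       \<and> (\<forall>q. measure_pmf.prob (G_pmf \<sigma> n \<Omega> y (p q)) {True}
               = exp (- a_coef \<sigma> * b_shift n \<Omega> y) * reduced_likelihood \<sigma> \<Sigma> p q y)"
proof (intro conjI allI)
  have sym: "transpose \<Omega> = \<Omega>"
    using assms(4) by (simp add: sym_posdef_def)
  have P: "p q $ j \<in> {0..1}" for q j
    using assms(5) by simp
  show "measure_pmf.expectation (K_pmf n (p q)) (beta n \<Omega> y)
          = (p q - y) \<bullet> (\<Omega> *v (p q - y))" for q
    using sym P assms(6) by (rule expectation_beta)
  show "\<forall>k\<in>grid n. 0 \<le> H_param n \<Omega> y k \<and> H_param n \<Omega> y k \<le> 1"
    using H_param_bounds by blast
  show "measure_pmf.prob (G_pmf \<sigma> n \<Omega> y (p q)) {True}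
          = exp (- a_coef \<sigma> * b_shift n \<Omega> y) * reduced_likelihood \<sigma> \<Sigma> p q y" for q
  proof -
    have a_pos: "0 < a_coef \<sigma>"
      using assms(1) by (simp add: a_coef_def)
    let ?Q = "(p q - y) \<bullet> (\<Omega> *v (p q - y))"
    have "measure_pmf.prob (G_pmf \<sigma> n \<Omega> y (p q)) {True}
        = exp (- a_coef \<sigma> * C_bound n \<Omega> y * ((?Q + b_shift n \<Omega> y) / C_bound n \<Omega> y))"
      by (simp add: measure_pmf_single pmf_G_True[OF a_pos] pmf_H_True[OF sym P assms(6)])
    also have "\<dots> = exp (- a_coef \<sigma> * b_shift n \<Omega> y + - a_coef \<sigma> * ?Q)"
      using C_bound_ge_1[of n \<Omega> y] by (simp add: distrib_left diff_divide_distrib)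
    also have "\<dots> = exp (- a_coef \<sigma> * b_shift n \<Omega> y) * reduced_likelihood \<sigma> \<Sigma> p q y"
      by (simp only: exp_add reduced_likelihood_def assms(3))
    finally show ?thesis .
  qed
qed

end
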